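(* Let $\mu$ and $\nu$ be two probability measures supported on $[\lambda_{\min},\lambda_{\max}]$, let $J\Subset I_{\mathrm{int}}$ be a fixed compact interval, and define for $t\in J$ $$u_\mu^*(t):=\int_{\lambda_{\min}}^{\lambda_{\max}}m\left(t+\frac1\ell\right)\mu(\mathrm d\ell),\qquad u_\nu^*(t):=\int_{\lambda_{\min}}^{\lambda_{\max}}m\left(t+\frac1\ell\right)\nu(\mathrm d\ell).$$ Assume that $m$ is Lipschitz continuous with Lipschitz constant $L_m$. Then $$\|u_\mu^*-u_\nu^*\|_{L^\infty(J)}\le\frac{L_m}{\lambda_{\min}^2}\,W_1(\mu,\nu),$$ $$\|u_\mu^*-u_\nu^*\|_{L^2(J)}\le\frac{L_m\sqrt{|J|}}{\lambda_{\min}^2}\,W_1(\mu,\nu).$$ In particular, the optimal control depends Lipschitz continuously on the velocity distribution with respect to the Wasserstein-1 distance.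
   Context: Here $0<\lambda_{\min}<\lambda_{\max}$, $T>0$, and $$I_{\mathrm{int}}:=\left[\frac1{\lambda_{\min}}-\frac1{\lambda_{\max}},\,T-\frac1{\lambda_{\min}}\right]$$ is assumed nonempty. $D:[0,T]\times\Omega\to[0,\infty)$ is a jointly measurable stochastic process on a probability space $(\Omega,\mathcal F,\mathbb P)$ with $D\in L^2(\Omega\times(0,T))$, and $m(t):=\mathbb E[D(t)]$, $t\in[0,T]$, is its mean. $J\Subset I_{\mathrm{int}}$ means $J$ is a compact interval compactly contained in $I_{\mathrm{int}}$; $|J|$ is its length. $W_1$ denotes the Wasserstein-1 distance on probability measures over $[\lambda_{\min},\lambda_{\max}]$ with the cost $|\ell_1-\ell_2|$. The functions $u_\mu^*,u_\nu^*$ are the optimal inflow controls on $J$ corresponding to the velocity laws $\mu,\nu$. *)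

theory Defs
  imports "HOL-Probability.Probability"
begin

text \<open>Probability laws are Borel measures on the whole line; being supported on the closed
  set \<open>A\<close> means that the complement of \<open>A\<close> is a null set.\<close>

definition prob_law_on :: "real set \<Rightarrow> real measure \<Rightarrow> bool" where
  "prob_law_on A \<mu> \<longleftrightarrow> prob_space \<mu> \<and> sets \<mu> = sets borel \<and> emeasure \<mu> (- A) = 0"

definition couplings :: "real measure \<Rightarrow> real measure \<Rightarrow> (real \<times> real) measure set" where
  "couplings \<mu> \<nu> =
     {\<pi>. sets \<pi> = sets (borel \<Otimes>\<^sub>M borel) \<and> distr \<pi> borel fst = \<mu> \<and> distr \<pi> borel snd = \<nu>}"

text \<open>For laws supported on \<open>A\<close>, every coupling is automatically supported on \<open>A \<times> A\<close>, so this is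
  also the Wasserstein distance for probability measures over \<open>A\<close>.\<close>

definition wasserstein1 :: "real measure \<Rightarrow> real measure \<Rightarrow> ennreal" where
  "wasserstein1 \<mu> \<nu> = (INF \<pi>\<in>couplings \<mu> \<nu>. \<integral>\<^sup>+(x, y). ennreal \<bar>x - y\<bar> \<partial>\<pi>)"

text \<open>Both norms take the value \<open>\<infinity>\<close> on functions outside the respective space, including
  non-measurable ones (for \<open>esssup\<close> this is part of the library definition), so a finite
  bound entails membership.\<close>

definition Linf_norm :: "'a measure \<Rightarrow> ('a \<Rightarrow> real) \<Rightarrow> ennreal" where
  "Linf_norm M f = (if f \<in> borel_measurable M then esssup M (\<lambda>x. ennreal \<bar>f x\<bar>) else \<infinity>)"

definition L2_norm :: "'a measure \<Rightarrow> ('a \<Rightarrow> real) \<Rightarrow> ennreal" where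
  "L2_norm M f =
     (if f \<in> borel_measurable M \<and> integrable M (\<lambda>x. (f x)\<^sup>2)
      then ennreal (sqrt (LINT x|M. (f x)\<^sup>2)) else \<infinity>)"

definition int_interval :: "real \<Rightarrow> real \<Rightarrow> real \<Rightarrow> real set" where
  "int_interval lmin lmax T = {1 / lmin - 1 / lmax .. T - 1 / lmin}"

text \<open>The ambient interval is itself compact and may be degenerate, so no interior is taken here.
  Asking for \<open>closure J \<subseteq> interior I\<close> instead is a more restrictive condition.\<close>

definition compactly_contained :: "real set \<Rightarrow> real set \<Rightarrow> bool" where
  "compactly_contained J I \<longleftrightarrow> compact (closure J) \<and> closure J \<subseteq> I"

definition optimal_inflow :: "real \<Rightarrow> real \<Rightarrow> (real \<Rightarrow> real) \<Rightarrow> real measure \<Rightarrow> real \<Rightarrow> real" where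
  "optimal_inflow lmin lmax m \<mu> t = (LINT l:{lmin..lmax}|\<mu>. m (t + 1 / l))"

end

(*
  Any coupling of the two laws turns the difference of the controls at t into the integral of
  m (t + 1/x) - m (t + 1/y).  Since 1/l is Lipschitz on [lmin, lmax] with constant 1/lmin^2, the
  integrand is at most Lm/lmin^2 * |x - y|; taking the infimum over couplings gives the uniform
  bound, and the L^2 bound follows because J has finite measure.
*)
theory Submission
  imports Defs
begin

section \<open>Infima in the extended nonnegative reals and comparison of norms\<close>

text \<open>For \<open>c\<close> positive and finite, divide by \<open>c\<close>, pass to the
  infimum and multiply back. For \<open>c = 0\<close> each bound forces \<open>x = 0\<close>; there
  nonemptiness of \<open>I\<close> is what supplies a bound at all.\<close>

lemma ennreal_le_mult_INF:
  fixes f :: "'a \<Rightarrow> ennreal"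
  assumes "I \<noteq> {}" "c \<noteq> \<top>" and le: "\<And>i. i \<in> I \<Longrightarrow> x \<le> c * f i"
  shows "x \<le> c * (INF i\<in>I. f i)"
proof (cases "c = 0")
  case True
  with assms show ?thesis by auto
next
  case False
  have "x / c \<le> f i" if "i \<in> I" for i
    using le[OF that] False \<open>c \<noteq> \<top>\<close>
    by (metis divide_right_mono_ennreal ennreal_mult_divide_eq mult.commute)
  then have "x / c \<le> (INF i\<in>I. f i)"
    by (rule INF_greatest)
  then have "x / c * c \<le> (INF i\<in>I. f i) * c"
    by (rule mult_right_mono) simp
  moreover have "x / c * c = x"
    using False \<open>c \<noteq> \<top>\<close> by (simp add: ennreal_divide_times top.not_eq_extremum)
  ultimately show ?thesis
    by (simp add: mult.commute)
qed

text \<open>If the essential supremum is a real \<open>c\<close>, then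
  \<open>(f x)\<^sup>2 \<le> c\<^sup>2\<close> almost everywhere, and integrating a constant
  produces the total mass. The bound also yields integrability, so the left side is not the default
  value \<open>\<infinity>\<close>.\<close>

lemma L2_norm_le_Linf_norm:
  assumes "finite_measure M" and f[measurable]: "f \<in> borel_measurable M"
  shows "L2_norm M f \<le> ennreal (sqrt (measure M (space M))) * Linf_norm M f"
proof -
  interpret finite_measure M by fact
  show ?thesis
  proof (cases "Linf_norm M f")
    case (real c)
    have "AE x in M. ennreal \<bar>f x\<bar> \<le> Linf_norm M f"
      using esssup_AE[of "\<lambda>x. ennreal \<bar>f x\<bar>" M] f by (simp add: Linf_norm_def)
    then have AE: "AE x in M. (f x)\<^sup>2 \<le> c\<^sup>2"
    proof eventually_elim
      case (elim x)
      with real have "\<bar>f x\<bar> \<le> c"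
        by simp
      from power_mono[OF this, of 2] show ?case
        by simp
    qed
    then have int: "integrable M (\<lambda>x. (f x)\<^sup>2)"
      by (intro integrable_const_bound[where B = "c\<^sup>2"]) auto
    have "(LINT x|M. (f x)\<^sup>2) \<le> (LINT x|M. c\<^sup>2)"
      by (intro integral_mono_AE int AE) simp
    also have "\<dots> = measure M (space M) * c\<^sup>2"
      by simp
    \<comment> \<open>The case split supplies \<open>0 \<le> c\<close>, so the root of
      \<open>c\<^sup>2\<close> is \<open>c\<close> itself.\<close>
    finally have "sqrt (LINT x|M. (f x)\<^sup>2) \<le> sqrt (measure M (space M)) * c"
      using real by (metis real_sqrt_le_mono real_sqrt_mult real_sqrt_unique)
    then show ?thesis
      using real int f by (simp add: L2_norm_def flip: ennreal_mult)
  next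
    case top
    show ?thesis
    \<comment> \<open>Since \<open>0 * \<top> = 0\<close>, the right side is infinite only when the
      space has positive mass. On a null space the left side is computed to be 0 instead.\<close>
    proof (cases "measure M (space M) = 0")
      case True
      then have "emeasure M (space M) = 0"
        by (simp add: emeasure_eq_measure)
      then have AE: "AE x in M. (f x)\<^sup>2 = 0"
        by (intro AE_I[where N = "space M"]) auto
      then have "integrable M (\<lambda>x. (f x)\<^sup>2)"
        by (subst integrable_cong_AE[where g = "\<lambda>_. 0"]) auto
      moreover have "(LINT x|M. (f x)\<^sup>2) = 0"
        using AE by (intro integral_eq_zero_AE)
      ultimately show ?thesis
        using f by (simp add: L2_norm_def)
    next
      case False
      then show ?thesis
        using top by (simp add: ennreal_mult_top zero_less_measure_iff)
    qed
  qed
qed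

section \<open>Couplings and the transport bound for Lipschitz integrands\<close>

text \<open>The independent coupling, that is the product measure, is a witness. It supplies the
  nonempty index set for the infimum that defines \<open>wasserstein1\<close>.\<close>

lemma couplings_nonempty:
  assumes "prob_space \<mu>" "prob_space \<nu>" "sets \<mu> = sets borel" "sets \<nu> = sets borel"
  shows "couplings \<mu> \<nu> \<noteq> {}"
proof -
  interpret mu: prob_space \<mu> by fact
  interpret nu: prob_space \<nu> by fact
  have "distr (\<mu> \<Otimes>\<^sub>M \<nu>) borel fst = distr (\<mu> \<Otimes>\<^sub>M \<nu>) \<mu> fst"
    using assms by (auto intro!: distr_cong)
  then have "distr (\<mu> \<Otimes>\<^sub>M \<nu>) borel fst = \<mu>"
    using nu.distr_pair_fst[of \<mu>] by simp
  moreover have "distr (\<mu> \<Otimes>\<^sub>M \<nu>) borel snd = \<nu>"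
  proof (rule measure_eqI)
    fix A assume "A \<in> sets (distr (\<mu> \<Otimes>\<^sub>M \<nu>) borel snd)"
    then have A: "A \<in> sets \<nu>" "A \<in> sets borel"
      using assms by simp_all
    have snd: "snd \<in> measurable (\<mu> \<Otimes>\<^sub>M \<nu>) borel"
      using measurable_snd[of \<mu> \<nu>] assms by (simp cong: measurable_cong_sets)
    \<comment> \<open>The preimage is a rectangle whose first side has mass 1, so its product
      measure is the \<open>\<nu>\<close>-measure of \<open>A\<close>.\<close>
    have "snd -` A \<inter> space (\<mu> \<Otimes>\<^sub>M \<nu>) = space \<mu> \<times> A"
      using sets.sets_into_space[OF A(1)] by (auto simp: space_pair_measure)
    with A show "emeasure (distr (\<mu> \<Otimes>\<^sub>M \<nu>) borel snd) A = emeasure \<nu> A"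
      by (simp add: emeasure_distr[OF snd] nu.emeasure_pair_measure_Times mu.emeasure_space_1)
  qed (use assms in simp)
  moreover have "sets (\<mu> \<Otimes>\<^sub>M \<nu>) = sets (borel \<Otimes>\<^sub>M borel)"
    using assms by (intro sets_pair_measure_cong)
  ultimately show ?thesis
    unfolding couplings_def by blast
qed

text \<open>This is the easy half of Kantorovich-Rubinstein duality: under any coupling both
  integrals live on one space, where the Lipschitz bound turns their difference into transport cost.
  Boundedness of \<open>g\<close> on \<open>A\<close> provides integrability.\<close>

lemma abs_integral_diff_le_wasserstein1:
  fixes g :: "real \<Rightarrow> real"
  assumes mu: "prob_law_on A \<mu>" and nu: "prob_law_on A \<nu>"
    and A: "A \<in> sets borel" and g: "K-lipschitz_on A g" and bnd: "bounded (g ` A)"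
    and meas: "set_borel_measurable borel A g"
  shows "ennreal \<bar>(LINT l:A|\<mu>. g l) - (LINT l:A|\<nu>. g l)\<bar> \<le> ennreal K * wasserstein1 \<mu> \<nu>"
  unfolding wasserstein1_def
proof (rule ennreal_le_mult_INF)
  show "couplings \<mu> \<nu> \<noteq> {}"
    using mu nu by (intro couplings_nonempty) (auto simp: prob_law_on_def)
next
  fix \<pi> assume "\<pi> \<in> couplings \<mu> \<nu>"
  then have sets_\<pi>: "sets \<pi> = sets (borel \<Otimes>\<^sub>M borel)"
    and fst: "distr \<pi> borel fst = \<mu>" and snd: "distr \<pi> borel snd = \<nu>"
    by (auto simp: couplings_def)
  \<comment> \<open>Extending \<open>g\<close> by zero off \<open>A\<close> lets it be composed with
    both projections. The extension may jump at the boundary of \<open>A\<close>, so the Lipschitz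
    estimate is used only for pairs in \<open>A \<times> A\<close>.\<close>
  define h where "h = (\<lambda>l. indicator A l *\<^sub>R g l)"
  have h[measurable]: "h \<in> borel_measurable borel"
    using meas by (simp add: h_def set_borel_measurable_def)
  have [measurable]: "fst \<in> measurable \<pi> borel" "snd \<in> measurable \<pi> borel"
    by (simp_all add: measurable_cong_sets[OF sets_\<pi> refl])
  \<comment> \<open>A coupling is only required to have the right marginals; its total mass 1 is
    recovered from the first one.\<close>
  have "prob_space (distr \<pi> borel fst)"
    using mu fst by (simp add: prob_law_on_def)
  then interpret prob_space \<pi>
    by (rule prob_space_distrD[rotated]) simp
  obtain B where B: "\<And>l. l \<in> A \<Longrightarrow> \<bar>g l\<bar> \<le> B"
    using bnd by (auto simp: bounded_iff)
  \<comment> \<open>The absolute value of \<open>B\<close> covers the points off \<open>A\<close>,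
    where \<open>h\<close> is 0: for empty \<open>A\<close> the bound \<open>B\<close> could be
    negative.\<close>
  have "\<bar>h l\<bar> \<le> \<bar>B\<bar>" for l
    using B[of l] by (auto simp: h_def indicator_def)
  then have int: "integrable \<pi> (\<lambda>p. h (fst p))" "integrable \<pi> (\<lambda>p. h (snd p))"
    by (auto intro!: integrable_const_bound[where B = "\<bar>B\<bar>"])
  have "(LINT l:A|\<mu>. g l) = (LINT p|\<pi>. h (fst p))"
    unfolding set_lebesgue_integral_def fst[symmetric] h_def[symmetric]
    by (rule integral_distr) measurable
  moreover have "(LINT l:A|\<nu>. g l) = (LINT p|\<pi>. h (snd p))"
    unfolding set_lebesgue_integral_def snd[symmetric] h_def[symmetric]
    by (rule integral_distr) measurable
  ultimately have "(LINT l:A|\<mu>. g l) - (LINT l:A|\<nu>. g l) = (LINT p|\<pi>. h (fst p) - h (snd p))"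
    using int by simp
  then have "ennreal \<bar>(LINT l:A|\<mu>. g l) - (LINT l:A|\<nu>. g l)\<bar>
      \<le> (\<integral>\<^sup>+p. ennreal \<bar>h (fst p) - h (snd p)\<bar> \<partial>\<pi>)"
    using integral_norm_bound_ennreal[of \<pi> "\<lambda>p. h (fst p) - h (snd p)"] int by simp
  also have "\<dots> \<le> (\<integral>\<^sup>+p. ennreal K * ennreal \<bar>fst p - snd p\<bar> \<partial>\<pi>)"
  proof (rule nn_integral_mono_AE)
    \<comment> \<open>Full mass of \<open>A\<close> under both marginals puts almost every pair of
      the coupling in \<open>A \<times> A\<close>.\<close>
    have "AE l in \<mu>. l \<in> A" "AE l in \<nu>. l \<in> A"
      using mu nu A by (auto simp: prob_law_on_def intro!: AE_I[where N = "- A"])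
    then have "AE p in \<pi>. fst p \<in> A" "AE p in \<pi>. snd p \<in> A"
      using A unfolding fst[symmetric] snd[symmetric] by (simp_all add: AE_distr_iff)
    then show "AE p in \<pi>. ennreal \<bar>h (fst p) - h (snd p)\<bar> \<le> ennreal K * ennreal \<bar>fst p - snd p\<bar>"
    proof eventually_elim
      case (elim p)
      then have "\<bar>h (fst p) - h (snd p)\<bar> \<le> K * \<bar>fst p - snd p\<bar>"
        using lipschitz_onD[OF g, of "fst p" "snd p"] by (simp add: h_def dist_real_def)
      then show ?case
        using lipschitz_on_nonneg[OF g] by (simp flip: ennreal_mult)
    qed
  qed
  also have "\<dots> = ennreal K * (\<integral>\<^sup>+p. ennreal \<bar>fst p - snd p\<bar> \<partial>\<pi>)"
    by (rule nn_integral_cmult) measurable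
  finally show "ennreal \<bar>(LINT l:A|\<mu>. g l) - (LINT l:A|\<nu>. g l)\<bar>
      \<le> ennreal K * (\<integral>\<^sup>+(x, y). ennreal \<bar>x - y\<bar> \<partial>\<pi>)"
    by (simp add: case_prod_unfold)
qed simp

section \<open>Dependence of the shifted mean on the velocity\<close>

text \<open>The difference \<open>1 / x - 1 / y\<close> equals \<open>(y - x) / (x * y)\<close>, and
  the denominator is at least \<open>c\<^sup>2\<close>.\<close>

lemma inverse_lipschitz_on_Icc:
  fixes c d :: real
  assumes "0 < c"
  shows "(1 / c\<^sup>2)-lipschitz_on {c..d} (\<lambda>l. 1 / l)"
proof (rule lipschitz_onI)
  fix x y assume xy: "x \<in> {c..d}" "y \<in> {c..d}"
  then have pos: "0 < x" "0 < y"
    using assms by auto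
  have "c\<^sup>2 \<le> x * y"
    using xy assms by (auto simp: power2_eq_square intro!: mult_mono)
  then have "\<bar>x - y\<bar> / (x * y) \<le> \<bar>x - y\<bar> / c\<^sup>2"
    using assms by (intro divide_left_mono) (use pos in auto)
  moreover have "1 / x - 1 / y = (y - x) / (x * y)"
    using pos by (simp add: field_simps)
  ultimately show "dist (1 / x) (1 / y) \<le> 1 / c\<^sup>2 * dist x y"
    using pos by (simp add: dist_real_def abs_minus_commute abs_mult)
qed simp

context
  fixes lmin lmax T Lm :: real and m :: "real \<Rightarrow> real"
  assumes lmin: "0 < lmin" and m: "Lm-lipschitz_on {0..T} m"
begin

text \<open>The right end of the interval leaves room for the longest delay \<open>1 / lmin\<close>,
  and times in it are nonnegative because \<open>1 / lmax \<le> 1 / lmin\<close>. Hence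
  \<open>m\<close> is evaluated only where its Lipschitz bound is assumed.\<close>

lemma shifted_time_in_range:
  assumes "t \<in> int_interval lmin lmax T" "l \<in> {lmin..lmax}"
  shows "t + 1 / l \<in> {0..T}"
proof -
  have "1 / lmax \<le> 1 / l" "1 / l \<le> 1 / lmin" "1 / lmax \<le> 1 / lmin" "0 < 1 / l"
    using assms lmin by (auto intro!: divide_left_mono)
  with assms show ?thesis
    by (auto simp: int_interval_def)
qed

text \<open>Composing \<open>m\<close> with the delay \<open>1 / l\<close> multiplies the constants
  \<open>Lm\<close> and \<open>1 / lmin\<^sup>2\<close>.\<close>

lemma shifted_mean_lipschitz:
  assumes "t \<in> int_interval lmin lmax T"
  shows "(Lm / lmin\<^sup>2)-lipschitz_on {lmin..lmax} (\<lambda>l. m (t + 1 / l))"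
proof (rule lipschitz_onI)
  fix x y assume xy: "x \<in> {lmin..lmax}" "y \<in> {lmin..lmax}"
  have "dist (m (t + 1 / x)) (m (t + 1 / y)) \<le> Lm * dist (1 / x) (1 / y)"
    using lipschitz_onD[OF m shifted_time_in_range[OF assms xy(1)] shifted_time_in_range[OF assms xy(2)]]
    by simp
  also have "\<dots> \<le> Lm * (1 / lmin\<^sup>2 * dist x y)"
    by (intro mult_left_mono lipschitz_onD[OF inverse_lipschitz_on_Icc[OF lmin] xy]
        lipschitz_on_nonneg[OF m])
  finally show "dist (m (t + 1 / x)) (m (t + 1 / y)) \<le> Lm / lmin\<^sup>2 * dist x y"
    by simp
qed (use lipschitz_on_nonneg[OF m] in simp)

text \<open>The Lipschitz bound controls \<open>m\<close> only on \<open>{0..T}\<close>, so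
  measurability is claimed for the truncation to the velocity interval, on which the integrand is
  continuous.\<close>

lemma shifted_mean_measurable:
  assumes "t \<in> int_interval lmin lmax T"
  shows "set_borel_measurable borel {lmin..lmax} (\<lambda>l. m (t + 1 / l))"
  unfolding set_borel_measurable_def
  by (intro borel_measurable_continuous_on_indicator
      lipschitz_on_continuous_on[OF shifted_mean_lipschitz] assms) simp

lemma shifted_mean_bounded:
  assumes "t \<in> int_interval lmin lmax T"
  shows "bounded ((\<lambda>l. m (t + 1 / l)) ` {lmin..lmax})"
  by (intro compact_imp_bounded compact_continuous_image
      lipschitz_on_continuous_on[OF shifted_mean_lipschitz] assms) simp

lemma shifted_mean_integrable:
  assumes "t \<in> int_interval lmin lmax T" and \<mu>: "prob_law_on {lmin..lmax} \<mu>"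
  shows "set_integrable \<mu> {lmin..lmax} (\<lambda>l. m (t + 1 / l))"
proof -
  interpret prob_space \<mu>
    using \<mu> by (simp add: prob_law_on_def)
  obtain B where B: "\<And>l. l \<in> {lmin..lmax} \<Longrightarrow> \<bar>m (t + 1 / l)\<bar> \<le> B"
    using shifted_mean_bounded[OF assms(1)] unfolding bounded_iff real_norm_def by blast
  have "(\<lambda>l. indicator {lmin..lmax} l *\<^sub>R m (t + 1 / l)) \<in> borel_measurable \<mu>"
    using shifted_mean_measurable[OF assms(1)] \<mu>
    by (simp add: set_borel_measurable_def prob_law_on_def cong: measurable_cong_sets)
  moreover have "AE l in \<mu>. norm (indicator {lmin..lmax} l *\<^sub>R m (t + 1 / l)) \<le> \<bar>B\<bar>"
    using B by (intro AE_I2) (force simp: indicator_def)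
  ultimately show ?thesis
    unfolding set_integrable_def by (intro integrable_const_bound)
qed

section \<open>Regularity of the control in time and the two norm bounds\<close>

text \<open>For each fixed \<open>l\<close> the shift preserves the constant of \<open>m\<close>,
  and so does averaging against a probability law. The resulting continuity in time gives the
  measurability without which both norms are \<open>\<infinity>\<close> by definition.\<close>

lemma optimal_inflow_lipschitz:
  assumes \<mu>: "prob_law_on {lmin..lmax} \<mu>"
  shows "Lm-lipschitz_on (int_interval lmin lmax T) (optimal_inflow lmin lmax m \<mu>)"
proof (rule lipschitz_onI)
  interpret prob_space \<mu>
    using \<mu> by (simp add: prob_law_on_def)
  fix s t assume st: "s \<in> int_interval lmin lmax T" "t \<in> int_interval lmin lmax T"
  let ?d = "\<lambda>l. indicator {lmin..lmax} l *\<^sub>R (m (s + 1 / l) - m (t + 1 / l))"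
  have int: "integrable \<mu> ?d"
    using set_integral_diff(1)[OF shifted_mean_integrable[OF st(1) \<mu>] shifted_mean_integrable[OF st(2) \<mu>]]
    by (simp add: set_integrable_def)
  have "dist (optimal_inflow lmin lmax m \<mu> s) (optimal_inflow lmin lmax m \<mu> t) = norm (LINT l|\<mu>. ?d l)"
    using set_integral_diff(2)[OF shifted_mean_integrable[OF st(1) \<mu>] shifted_mean_integrable[OF st(2) \<mu>]]
    by (simp add: optimal_inflow_def set_lebesgue_integral_def dist_norm)
  also have "\<dots> \<le> (LINT l|\<mu>. norm (?d l))"
    by (rule integral_norm_bound)
  also have "\<dots> \<le> Lm * dist s t"
  proof (rule integral_le_const)
    have "norm (?d l) \<le> Lm * dist s t" for l
    proof (cases "l \<in> {lmin..lmax}")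
      case True
      from lipschitz_onD[OF m shifted_time_in_range[OF st(1) True] shifted_time_in_range[OF st(2) True]]
      show ?thesis
        using True by (simp add: dist_real_def)
    qed (simp add: lipschitz_on_nonneg[OF m])
    then show "AE l in \<mu>. norm (?d l) \<le> Lm * dist s t"
      by (intro AE_I2)
  qed (use int in \<open>rule integrable_norm\<close>)
  finally show "dist (optimal_inflow lmin lmax m \<mu> s) (optimal_inflow lmin lmax m \<mu> t) \<le> Lm * dist s t" .
qed (rule lipschitz_on_nonneg[OF m])

lemma optimal_inflow_diff_le_wasserstein1:
  assumes "prob_law_on {lmin..lmax} \<mu>" "prob_law_on {lmin..lmax} \<nu>"
    and "{a..b} \<subseteq> int_interval lmin lmax T"
  defines "f \<equiv> \<lambda>t. optimal_inflow lmin lmax m \<mu> t - optimal_inflow lmin lmax m \<nu> t"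
  shows "Linf_norm (lebesgue_on {a..b}) f \<le> ennreal (Lm / lmin\<^sup>2) * wasserstein1 \<mu> \<nu>" (is ?Linf)
    and "L2_norm (lebesgue_on {a..b}) f
           \<le> ennreal (Lm * sqrt (measure lebesgue {a..b}) / lmin\<^sup>2) * wasserstein1 \<mu> \<nu>" (is ?L2)
proof -
  have "continuous_on {a..b} (optimal_inflow lmin lmax m \<rho>)" if "prob_law_on {lmin..lmax} \<rho>" for \<rho>
    using lipschitz_on_continuous_on[OF optimal_inflow_lipschitz[OF that]] assms(3)
    by (rule continuous_on_subset)
  then have "continuous_on {a..b} f"
    unfolding f_def using assms(1,2) by (intro continuous_on_diff)
  then have f: "f \<in> borel_measurable (lebesgue_on {a..b})"
    by (rule continuous_imp_measurable_on_sets_lebesgue) simp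
  \<comment> \<open>The transport bound is applied at each fixed \<open>t\<close> to
    \<open>m (t + 1 / l)\<close> as a function of \<open>l\<close>. Its constant does not depend on
    \<open>t\<close>, so it passes to the essential supremum.\<close>
  have "ennreal \<bar>f t\<bar> \<le> ennreal (Lm / lmin\<^sup>2) * wasserstein1 \<mu> \<nu>" if "t \<in> {a..b}" for t
    unfolding f_def optimal_inflow_def
    by (rule abs_integral_diff_le_wasserstein1)
      (use assms that in \<open>auto intro!: shifted_mean_lipschitz shifted_mean_bounded shifted_mean_measurable\<close>)
  then have "AE t in lebesgue_on {a..b}. ennreal \<bar>f t\<bar> \<le> ennreal (Lm / lmin\<^sup>2) * wasserstein1 \<mu> \<nu>"
    by (intro AE_I2) simp
  with f show Linf: ?Linf
    unfolding Linf_norm_def by (simp only: if_True) (intro esssup_I; measurable)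
  have "finite_measure (lebesgue_on {a..b})"
    by (rule finite_measure_lebesgue_on) simp
  from L2_norm_le_Linf_norm[OF this f]
  have "L2_norm (lebesgue_on {a..b}) f
      \<le> ennreal (sqrt (measure lebesgue {a..b})) * Linf_norm (lebesgue_on {a..b}) f"
    by (simp add: measure_restrict_space)
  also have "\<dots> \<le> ennreal (sqrt (measure lebesgue {a..b})) * (ennreal (Lm / lmin\<^sup>2) * wasserstein1 \<mu> \<nu>)"
    using Linf by (rule mult_left_mono) simp
  \<comment> \<open>Merging the factors inside \<open>ennreal\<close> uses their nonnegativity,
    which for \<open>Lm\<close> comes with the Lipschitz hypothesis.\<close>
  also have "\<dots> = ennreal (Lm * sqrt (measure lebesgue {a..b}) / lmin\<^sup>2) * wasserstein1 \<mu> \<nu>"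
    using lipschitz_on_nonneg[OF m]
    by (simp add: mult.assoc[symmetric] mult.commute[of _ Lm] del: measure_lborel_Icc flip: ennreal_mult)
  finally show ?L2 .
qed

end

theorem theorem4p3:
  fixes \<Omega> :: "'w measure"
    and D :: "real \<Rightarrow> 'w \<Rightarrow> real"
    and m :: "real \<Rightarrow> real"
    and \<mu> \<nu> :: "real measure"
    and lmin lmax T a b Lm :: real
    and J :: "real set"
  assumes speeds: "0 < lmin" "lmin < lmax"
    and T_pos: "0 < T"
    and int_nonempty: "int_interval lmin lmax T \<noteq> {}"
    and prob: "prob_space \<Omega>"
    and D_measurable:
      "(\<lambda>(t, \<omega>). D t \<omega>) \<in> borel_measurable (restrict_space borel {0..T} \<Otimes>\<^sub>M \<Omega>)"
    and D_nonneg: "\<And>t \<omega>. t \<in> {0..T} \<Longrightarrow> \<omega> \<in> space \<Omega> \<Longrightarrow> 0 \<le> D t \<omega>"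
    and D_L2: "integrable (\<Omega> \<Otimes>\<^sub>M restrict_space lborel {0<..<T}) (\<lambda>(\<omega>, t). (D t \<omega>)\<^sup>2)"
    and m_mean: "\<And>t. t \<in> {0..T} \<Longrightarrow> m t = prob_space.expectation \<Omega> (D t)"
    and m_Lipschitz: "Lm-lipschitz_on {0..T} m"
    and J_interval: "a \<le> b" "J = {a..b}"
    and J_contained: "compactly_contained J (int_interval lmin lmax T)"
    and mu: "prob_law_on {lmin..lmax} \<mu>"
    and nu: "prob_law_on {lmin..lmax} \<nu>"
  shows
    "Linf_norm (lebesgue_on J)
        (\<lambda>t. optimal_inflow lmin lmax m \<mu> t - optimal_inflow lmin lmax m \<nu> t)
      \<le> ennreal (Lm / lmin\<^sup>2) * wasserstein1 \<mu> \<nu>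
    \<and> L2_norm (lebesgue_on J)
        (\<lambda>t. optimal_inflow lmin lmax m \<mu> t - optimal_inflow lmin lmax m \<nu> t)
      \<le> ennreal (Lm * sqrt (measure lebesgue J) / lmin\<^sup>2) * wasserstein1 \<mu> \<nu>
    \<and> (\<exists>C::real. 0 \<le> C \<and> (\<forall>\<mu>' \<nu>'. prob_law_on {lmin..lmax} \<mu>' \<and> prob_law_on {lmin..lmax} \<nu>' \<longrightarrow>
        Linf_norm (lebesgue_on J)
          (\<lambda>t. optimal_inflow lmin lmax m \<mu>' t - optimal_inflow lmin lmax m \<nu>' t)
          \<le> ennreal C * wasserstein1 \<mu>' \<nu>' \<and>
        L2_norm (lebesgue_on J)
          (\<lambda>t. optimal_inflow lmin lmax m \<mu>' t - optimal_inflow lmin lmax m \<nu>' t)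
          \<le> ennreal C * wasserstein1 \<mu>' \<nu>'))"
proof -
  \<comment> \<open>The interval is closed, so it equals its closure and compact containment gives
    plain inclusion.\<close>
  have J: "{a..b} \<subseteq> int_interval lmin lmax T"
    using J_contained J_interval by (simp add: compactly_contained_def)
  note bounds = optimal_inflow_diff_le_wasserstein1[OF speeds(1) m_Lipschitz _ _ J]
  \<comment> \<open>The Lipschitz claim asks for one constant serving both norms and all pairs of
    laws. The larger of these two works, since neither involves the laws.\<close>
  let ?C1 = "Lm / lmin\<^sup>2" and ?C2 = "Lm * sqrt (measure lebesgue J) / lmin\<^sup>2"
  let ?f = "\<lambda>\<mu> \<nu> t. optimal_inflow lmin lmax m \<mu> t - optimal_inflow lmin lmax m \<nu> t"
  have "0 \<le> max ?C1 ?C2"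
    using lipschitz_on_nonneg[OF m_Lipschitz] by (simp add: le_max_iff_disj)
  moreover have "Linf_norm (lebesgue_on J) (?f \<mu>' \<nu>') \<le> ennreal (max ?C1 ?C2) * wasserstein1 \<mu>' \<nu>' \<and>
      L2_norm (lebesgue_on J) (?f \<mu>' \<nu>') \<le> ennreal (max ?C1 ?C2) * wasserstein1 \<mu>' \<nu>'"
    if "prob_law_on {lmin..lmax} \<mu>'" "prob_law_on {lmin..lmax} \<nu>'" for \<mu>' \<nu>'
    unfolding J_interval(2)
    by (intro conjI order_trans[OF bounds(1)[OF that]] order_trans[OF bounds(2)[OF that]]
        mult_right_mono ennreal_leI) simp_all
  ultimately show ?thesis
    using bounds[OF mu nu] unfolding J_interval(2) by blast
qed

end
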